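(* The EXTRA algorithm is equivalent to applying one step of gradient descent to solve the subproblem $\min_{\mathbf X}P_k(\mathbf X)$ in the (non-accelerated) decentralized augmented Lagrangian framework.
   Context: Setting. The functions $f_i:\mathbb{R}^d\to\mathbb{R}$, $i=1,\dots,n$, are differentiable, $L$-smooth ($\nabla f_i$ is $L$-Lipschitz) and $\mu$-strongly convex ($f_i-\frac{\mu}{2}\|x\|^2$ is convex). For $\mathbf{X}=[x_1;\dots;x_n]\in\mathbb{R}^{nd}$, $F(\mathbf{X})=\frac1n\sum_{i=1}^nf_i(x_i)$. Mixing matrix. For a graph with vertex set $\{1,\dots,n\}$ and edge set $\mathcal E$, a mixing matrix is a symmetric positive semidefinite $W\in\mathbb{R}^{n\times n}$ with $W_{ij}=W_{ji}=0$ whenever $i\neq j$ and $(i,j)\notin\mathcal E$, and with kernel $\mathbb{R}\mathbf 1_n$, where $\mathbf 1_n$ is the all-ones vector. Write $\mathbf W=W\otimes I_d\in\mathbb{R}^{nd\times nd}$ and $\|\mathbf{X}\|^2_{\mathbf W}=\mathbf{X}^T\mathbf W\mathbf{X}$. Decentralized augmented Lagrangian framework. Inputs: a mixing matrix $W$, a regularization parameter $\rho$, a stepsize $\eta$. For $k=1,2,\dots$: $$\mathbf{X}_k=\arg\min_{\mathbf X}\left\{P_k(\mathbf{X}):=F(\mathbf{X})+\mathbf\Lambda_k^T\mathbf{X}+\frac\rho2\|\mathbf{X}\|^2_{\mathbf W}\right\},\qquad \mathbf\Lambda_{k+1}=\mathbf\Lambda_k+\eta\mathbf W\mathbf{X}_k.$$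 Applying one step of gradient descent to solve the subproblem means that the exact minimization of $P_k$ is replaced by a single gradient step on $P_k$, with some stepsize $\alpha>0$, warm-started at the previous iterate $\mathbf X_{k-1}$. EXTRA. Given a doubly stochastic matrix $W_{DS}\in\mathbb{R}^{n\times n}$ such that $I-W_{DS}$ is a mixing matrix, with $\mathbf W_{DS}=W_{DS}\otimes I_d$, and a stepsize $\alpha>0$, EXTRA is the algorithm with update rule $$\mathbf{X}_{k+1}=(I+\mathbf W_{DS})\mathbf{X}_k-\frac{I+\mathbf W_{DS}}{2}\,\mathbf{X}_{k-1}-\alpha\left(\nabla F(\mathbf{X}_k)-\nabla F(\mathbf{X}_{k-1})\right).$$ Correspondence of parameters. The mixing matrix of the framework is $W=I-W_{DS}$; in terms of $\rho$, the inner stepsize is $\alpha=\frac{1}{2\rho}$ and the outer stepsize is $\eta=\rho$. *)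

theory Defs
  imports "HOL-Analysis.Analysis"
begin

text \<open>A graph on the vertex type \<open>'n\<close> (so \<open>n = CARD('n)\<close>) is given by its adjacency relation
  \<open>E :: ('n \<times> 'n) set\<close>.  The vector space of all stacked vectors \<open>[x\<^sub>1; \<dots>; x\<^sub>n]\<close> with blocks in
  \<open>real ^ 'd\<close> is \<open>real ^ ('n \<times> 'd)\<close>: entry \<open>(i, a)\<close> is coordinate \<open>a\<close> of block \<open>i\<close>.\<close>

definition block :: "real ^ ('n::finite \<times> 'd::finite) \<Rightarrow> 'n \<Rightarrow> real ^ 'd"
  where "block X i = (\<chi> a. X $ (i, a))"

definition kronecker ::
    "real ^ 'n ^ 'n \<Rightarrow> real ^ 'd ^ 'd \<Rightarrow> real ^ ('n::finite \<times> 'd::finite) ^ ('n \<times> 'd)"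
  where "kronecker A B = (\<chi> p q. A $ fst p $ fst q * B $ snd p $ snd q)"

definition lift_mat :: "real ^ 'n ^ 'n \<Rightarrow> real ^ ('n::finite \<times> 'd::finite) ^ ('n \<times> 'd)"
  where "lift_mat A = kronecker A (mat 1)"

text \<open>Meaningful only at points of differentiability, where the vector is unique.\<close>

definition grad :: "('a::real_inner \<Rightarrow> real) \<Rightarrow> 'a \<Rightarrow> 'a"
  where "grad f x = (THE D. GDERIV f x :> D)"

definition smooth :: "real \<Rightarrow> ('a::real_inner \<Rightarrow> real) \<Rightarrow> bool"
  where "smooth L f \<longleftrightarrow> L-lipschitz_on UNIV (grad f)"

definition strongly_convex :: "real \<Rightarrow> ('a::real_inner \<Rightarrow> real) \<Rightarrow> bool"
  where "strongly_convex \<mu> f \<longleftrightarrow> convex_on UNIV (\<lambda>x. f x - \<mu> / 2 * (norm x)\<^sup>2)"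

definition mixing_matrix :: "('n::finite \<times> 'n) set \<Rightarrow> real ^ 'n ^ 'n \<Rightarrow> bool"
  where "mixing_matrix E W \<longleftrightarrow>
    transpose W = W \<and>
    (\<forall>x. 0 \<le> x \<bullet> (W *v x)) \<and>
    (\<forall>i j. i \<noteq> j \<and> (i, j) \<notin> E \<longrightarrow> W $ i $ j = 0 \<and> W $ j $ i = 0) \<and>
    {x. W *v x = 0} = span {1}"

definition doubly_stochastic :: "real ^ 'n ^ 'n::finite \<Rightarrow> bool"
  where "doubly_stochastic S \<longleftrightarrow>
    (\<forall>i j. 0 \<le> S $ i $ j) \<and>
    (\<forall>i. (\<Sum>j\<in>UNIV. S $ i $ j) = 1) \<and>
    (\<forall>j. (\<Sum>i\<in>UNIV. S $ i $ j) = 1)"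

definition avg_obj ::
    "('n::finite \<Rightarrow> real ^ 'd::finite \<Rightarrow> real) \<Rightarrow> real ^ ('n \<times> 'd) \<Rightarrow> real"
  where "avg_obj f X = 1 / real CARD('n) * (\<Sum>i\<in>UNIV. f i (block X i))"

text \<open>The objective \<open>P\<^sub>k\<close> of the \<open>k\<close>-th subproblem, with \<open>M\<close> the lifted mixing matrix and \<open>l\<close> the
  current multiplier.\<close>

definition aug_lagrangian ::
    "(real ^ 'm \<Rightarrow> real) \<Rightarrow> real ^ 'm ^ 'm \<Rightarrow> real \<Rightarrow> real ^ 'm::finite \<Rightarrow> real ^ 'm \<Rightarrow> real"
  where "aug_lagrangian F M \<rho> l X = F X + l \<bullet> X + \<rho> / 2 * (X \<bullet> (M *v X))"

text \<open>A subproblem solver is a relation \<open>solve P Y Z\<close>: from the warm start \<open>Y\<close> it may return \<open>Z\<close> for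
  the objective \<open>P\<close>.  The framework is stated for an arbitrary solver; \<open>exact_min\<close> gives the exact
  scheme and \<open>one_grad_step \<alpha>\<close> the scheme with a single gradient step.\<close>

definition exact_min :: "('a \<Rightarrow> real) \<Rightarrow> 'a \<Rightarrow> 'a \<Rightarrow> bool"
  where "exact_min P Y Z \<longleftrightarrow> is_arg_min P (\<lambda>_. True) Z"

definition one_grad_step :: "real \<Rightarrow> ('a::real_inner \<Rightarrow> real) \<Rightarrow> 'a \<Rightarrow> 'a \<Rightarrow> bool"
  where "one_grad_step \<alpha> P Y Z \<longleftrightarrow> Z = Y - \<alpha> *\<^sub>R grad P Y"

text \<open>\<open>X 0\<close> is the initial iterate, \<open>\<Lambda> 1\<close> the initial multiplier; \<open>\<Lambda> 0\<close> plays no role.\<close>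

definition dec_al_framework ::
    "((real ^ ('n \<times> 'd) \<Rightarrow> real) \<Rightarrow> real ^ ('n \<times> 'd) \<Rightarrow> real ^ ('n \<times> 'd) \<Rightarrow> bool) \<Rightarrow>
     (real ^ ('n \<times> 'd) \<Rightarrow> real) \<Rightarrow> real ^ 'n ^ 'n \<Rightarrow> real \<Rightarrow> real \<Rightarrow>
     (nat \<Rightarrow> real ^ ('n::finite \<times> 'd::finite)) \<Rightarrow> (nat \<Rightarrow> real ^ ('n \<times> 'd)) \<Rightarrow> bool"
  where "dec_al_framework solve F W \<rho> \<eta> X \<Lambda> \<longleftrightarrow>
    (\<forall>k\<ge>1. solve (aug_lagrangian F (lift_mat W) \<rho> (\<Lambda> k)) (X (k - 1)) (X k) \<and>
            \<Lambda> (k + 1) = \<Lambda> k + \<eta> *\<^sub>R (lift_mat W *v X k))"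

definition extra ::
    "(real ^ ('n \<times> 'd) \<Rightarrow> real) \<Rightarrow> real ^ 'n ^ 'n \<Rightarrow> real \<Rightarrow>
     (nat \<Rightarrow> real ^ ('n::finite \<times> 'd::finite)) \<Rightarrow> bool"
  where "extra F S \<alpha> X \<longleftrightarrow>
    (\<forall>k\<ge>1. X (k + 1) =
        (mat 1 + lift_mat S) *v X k
        - ((1 / 2) *\<^sub>R (mat 1 + lift_mat S)) *v X (k - 1)
        - \<alpha> *\<^sub>R (grad F (X k) - grad F (X (k - 1))))"

end

theory Submission
  imports Defs
begin

text \<open>
  Eliminating the multiplier turns the one-step scheme into EXTRA.  With \<open>M = I - W_DS\<close> and
  \<open>\<alpha> \<rho> = 1 / 2\<close>, a gradient step on the \<open>k\<close>-th augmented Lagrangian reads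
  \<open>X\<^sub>k = (I + W_DS) / 2 X\<^sub>k\<^sub>-\<^sub>1 - \<alpha> (\<nabla>F(X\<^sub>k\<^sub>-\<^sub>1) + \<Lambda>\<^sub>k)\<close>.  Subtracting this from the same equation
  for \<open>k + 1\<close> leaves the multipliers only through \<open>\<alpha> (\<Lambda>\<^sub>k\<^sub>+\<^sub>1 - \<Lambda>\<^sub>k) = (I - W_DS) / 2 X\<^sub>k\<close>, and the
  result is exactly the EXTRA update.  Hence, once the multipliers follow the dual update, the step
  \<open>k + 1\<close> is equivalent to the EXTRA update given the step \<open>k\<close>
  (\<open>next_step_iff_extra_update\<close>), so by induction the framework amounts to EXTRA together with its
  very first step (\<open>framework_iff_extra_and_first_step\<close>).

  The primal sequence and \<open>\<Lambda>\<^sub>1\<close> determine all later multipliers.  EXTRA leaves \<open>X\<^sub>1\<close> free, and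
  this freedom corresponds to that of \<open>\<Lambda>\<^sub>1\<close>: since \<open>\<alpha> \<noteq> 0\<close>, every pair \<open>X\<^sub>0, X\<^sub>1\<close> is joined by a
  gradient step for a suitable \<open>\<Lambda>\<^sub>1\<close>.

  The analytic input is that the gradient of the augmented Lagrangian is
  \<open>\<nabla>F(X) + \<Lambda> + \<rho> M X\<close>, which uses the symmetry of \<open>M\<close>.
\<close>

lemma GDERIV_imp_grad_eq:
  assumes "GDERIV f x :> D"
  shows "grad f x = D"
  unfolding grad_def
proof (rule the_equality, fact assms)
  fix D' assume "GDERIV f x :> D'"
  with assms have "(\<lambda>h. h \<bullet> D') = (\<lambda>h. h \<bullet> D)"
    unfolding gderiv_def by (metis has_derivative_unique)
  then have "(D' - D) \<bullet> D' = (D' - D) \<bullet> D" by metis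
  then have "(D' - D) \<bullet> (D' - D) = 0" by (simp only: inner_diff_right diff_self)
  then show "D' = D" by simp
qed

text \<open>In finite dimension the derivative is represented by a vector, so that the definite
  description in \<open>grad\<close> is meaningful at every point of differentiability.\<close>

lemma differentiable_imp_GDERIV_grad:
  fixes f :: "'a::euclidean_space \<Rightarrow> real"
  assumes "f differentiable (at x)"
  shows "GDERIV f x :> grad f x"
proof -
  obtain f' where f': "(f has_derivative f') (at x)"
    using assms unfolding differentiable_def by blast
  interpret linear f' using f' by (rule has_derivative_linear)
  let ?D = "adjoint f' 1"
  have "f' = (\<lambda>h. h \<bullet> ?D)"
    using adjoint_works[OF linear_axioms, of _ 1] by simp
  with f' have "GDERIV f x :> ?D" unfolding gderiv_def by simp
  then show ?thesis by (simp add: GDERIV_imp_grad_eq)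
qed

lemma differentiable_avg_obj:
  fixes f :: "'n::finite \<Rightarrow> real ^ 'd::finite \<Rightarrow> real"
  assumes "\<And>i. f i differentiable_on UNIV"
  shows "avg_obj f differentiable (at X)"
proof -
  have "linear (\<lambda>X :: real ^ ('n \<times> 'd). block X i)" for i
    by (rule linearI) (simp_all add: block_def vec_eq_iff)
  then have "(\<lambda>X. f i (block X i)) differentiable (at X)" for i
    using differentiable_chain_at[of "\<lambda>X. block X i" X "f i"] assms[of i]
    by (simp add: linear_imp_differentiable differentiable_on_def comp_def)
  then show ?thesis
    unfolding avg_obj_def by (intro differentiable_mult differentiable_sum) auto
qed

lemma GDERIV_aug_lagrangian:
  fixes M :: "real ^ 'm::finite ^ 'm"
  assumes "F differentiable (at Y)" and "transpose M = M"
  shows "GDERIV (aug_lagrangian F M \<rho> l) Y :> grad F Y + l + \<rho> *\<^sub>R (M *v Y)"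
proof -
  have F: "(F has_derivative (\<lambda>h. h \<bullet> grad F Y)) (at Y)"
    using differentiable_imp_GDERIV_grad[OF assms(1)] by (simp add: gderiv_def)
  have M: "((\<lambda>X. M *v X) has_derivative (\<lambda>h. M *v h)) (at Y)"
    by (rule bounded_linear.has_derivative[OF matrix_vector_mul_bounded_linear has_derivative_ident])
  \<comment> \<open>By symmetry both halves of the derivative of the quadratic form agree.\<close>
  have sym: "Y \<bullet> (M *v h) = h \<bullet> (M *v Y)" for h
    using assms(2) dot_lmul_matrix[of Y M h]
    by (metis inner_commute vector_transpose_matrix)
  have "((\<lambda>X. F X + l \<bullet> X + \<rho> / 2 * (X \<bullet> (M *v X))) has_derivative
      (\<lambda>h. h \<bullet> grad F Y + l \<bullet> h + \<rho> / 2 * (Y \<bullet> (M *v h) + h \<bullet> (M *v Y)))) (at Y)"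
    by (rule derivative_eq_intros F M refl | simp)+
  then show ?thesis
    unfolding gderiv_def aug_lagrangian_def sym
    by (simp add: inner_add_right inner_commute algebra_simps)
qed

lemma one_grad_step_aug_lagrangian_iff:
  fixes M :: "real ^ 'm::finite ^ 'm"
  assumes "F differentiable (at Y)" and "transpose M = M"
  shows "one_grad_step \<alpha> (aug_lagrangian F M \<rho> l) Y Z \<longleftrightarrow>
    Z = Y - \<alpha> *\<^sub>R (grad F Y + l + \<rho> *\<^sub>R (M *v Y))"
  unfolding one_grad_step_def GDERIV_imp_grad_eq[OF GDERIV_aug_lagrangian[OF assms]] ..

lemma transpose_lift_mat: "transpose (lift_mat A) = lift_mat (transpose A)"
  by (simp add: lift_mat_def kronecker_def transpose_def mat_def vec_eq_iff)

lemma lift_mat_mat_1_diff: "lift_mat (mat 1 - A) = mat 1 - lift_mat A"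
  by (auto simp: lift_mat_def kronecker_def mat_def vec_eq_iff prod_eq_iff)

text \<open>The difference of the residuals of two consecutive gradient steps is the residual of the
  EXTRA update.\<close>

lemma next_step_iff_extra_update:
  fixes S :: "real ^ 'm::finite ^ 'm"
  assumes half: "\<alpha> * \<rho> = 1 / 2"
    and step: "Y = Y0 - \<alpha> *\<^sub>R (g0 + l + \<rho> *\<^sub>R ((mat 1 - S) *v Y0))"
    and dual: "l' = l + \<rho> *\<^sub>R ((mat 1 - S) *v Y)"
  shows "Z = Y - \<alpha> *\<^sub>R (g + l' + \<rho> *\<^sub>R ((mat 1 - S) *v Y)) \<longleftrightarrow>
    Z = (mat 1 + S) *v Y - ((1 / 2) *\<^sub>R (mat 1 + S)) *v Y0 - \<alpha> *\<^sub>R (g - g0)"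
proof -
  have half_scale: "\<alpha> *\<^sub>R (\<rho> *\<^sub>R v) = (1 / 2) *\<^sub>R v" for v :: "real ^ 'm"
    using half by simp
  have l: "\<alpha> *\<^sub>R l = Y0 - Y - \<alpha> *\<^sub>R g0 - (1 / 2) *\<^sub>R (Y0 - S *v Y0)"
    using step by (simp add: scaleR_add_right half_scale matrix_vector_mult_diff_rdistrib
        algebra_simps del: scaleR_scaleR)
  have "Y - \<alpha> *\<^sub>R (g + l' + \<rho> *\<^sub>R ((mat 1 - S) *v Y)) =
      Y - \<alpha> *\<^sub>R g - \<alpha> *\<^sub>R l - (Y - S *v Y)"
    unfolding dual
    by (simp add: scaleR_add_right half_scale matrix_vector_mult_diff_rdistrib
        del: scaleR_scaleR) (simp add: vec_eq_iff field_simps)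
  also have "\<dots> = (mat 1 + S) *v Y - ((1 / 2) *\<^sub>R (mat 1 + S)) *v Y0 - \<alpha> *\<^sub>R (g - g0)"
    unfolding l scaleR_matrix_vector_assoc[symmetric] matrix_vector_mult_add_rdistrib
    by (simp add: vec_eq_iff field_simps)
  finally show ?thesis by simp
qed

lemma framework_iff_extra_and_first_step:
  fixes F :: "real ^ ('n::finite \<times> 'd::finite) \<Rightarrow> real"
  assumes diff: "\<And>Y. F differentiable (at Y)"
    and sym: "transpose W = W" and W: "W = mat 1 - S"
    and half: "\<alpha> * \<rho> = 1 / 2"
    and dual: "\<And>k. k \<ge> 1 \<Longrightarrow> \<Lambda> (k + 1) = \<Lambda> k + \<rho> *\<^sub>R (lift_mat W *v X k)"
  shows "dec_al_framework (one_grad_step \<alpha>) F W \<rho> \<rho> X \<Lambda> \<longleftrightarrow>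
    extra F S \<alpha> X \<and> one_grad_step \<alpha> (aug_lagrangian F (lift_mat W) \<rho> (\<Lambda> 1)) (X 0) (X 1)"
proof -
  define step where
    "step k \<longleftrightarrow> one_grad_step \<alpha> (aug_lagrangian F (lift_mat W) \<rho> (\<Lambda> k)) (X (k - 1)) (X k)" for k
  define upd where
    "upd k \<longleftrightarrow> X (k + 1) = (mat 1 + lift_mat S) *v X k
        - ((1 / 2) *\<^sub>R (mat 1 + lift_mat S)) *v X (k - 1)
        - \<alpha> *\<^sub>R (grad F (X k) - grad F (X (k - 1)))" for k
  have lift: "lift_mat W = (mat 1 - lift_mat S :: real ^ ('n \<times> 'd) ^ ('n \<times> 'd))"
    unfolding W by (rule lift_mat_mat_1_diff)
  have step_iff: "step k \<longleftrightarrow> X k = X (k - 1) - \<alpha> *\<^sub>R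
      (grad F (X (k - 1)) + \<Lambda> k + \<rho> *\<^sub>R ((mat 1 - lift_mat S) *v X (k - 1)))" for k
    unfolding step_def lift[symmetric]
    by (rule one_grad_step_aug_lagrangian_iff[OF diff]) (simp add: transpose_lift_mat sym)
  have next_iff: "step (k + 1) \<longleftrightarrow> upd k" if "k \<ge> 1" "step k" for k
    using next_step_iff_extra_update[OF half that(2)[unfolded step_iff]
        dual[OF that(1), unfolded lift], of "X (k + 1)" "grad F (X k)"]
    by (simp add: step_iff upd_def)
  have "(\<forall>k\<ge>1. step k) \<longleftrightarrow> (\<forall>k\<ge>1. upd k) \<and> step 1"
  proof (intro iffI conjI)
    assume all: "\<forall>k\<ge>1. step k"
    then show "step 1" by simp
    from all show "\<forall>k\<ge>1. upd k" using next_iff by simp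
  next
    assume upd: "(\<forall>k\<ge>1. upd k) \<and> step 1"
    have "step k" if "k \<ge> 1" for k
      using that by (induction k rule: dec_induct) (use upd next_iff in auto)
    then show "\<forall>k\<ge>1. step k" by blast
  qed
  then show ?thesis
    using dual unfolding dec_al_framework_def extra_def upd_def step_def by auto
qed

theorem proposition5:
  fixes f :: "'n::finite \<Rightarrow> real ^ 'd::finite \<Rightarrow> real"
    and E :: "('n \<times> 'n) set"
    and W W_DS :: "real ^ 'n ^ 'n"
    and L \<mu> \<alpha> \<rho> \<eta> :: real
    and X :: "nat \<Rightarrow> real ^ ('n \<times> 'd)"
  assumes "\<And>i. f i differentiable_on UNIV"
    and "\<And>i. smooth L (f i)"
    and "\<mu> > 0"
    and "\<And>i. strongly_convex \<mu> (f i)"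
    and "sym E"
    and "doubly_stochastic W_DS"
    and "W = mat 1 - W_DS"
    and "mixing_matrix E W"
    and "\<alpha> > 0"
    and "\<alpha> = 1 / (2 * \<rho>)"
    and "\<eta> = \<rho>"
  shows "(extra (avg_obj f) W_DS \<alpha> X \<longleftrightarrow>
            (\<exists>\<Lambda>. dec_al_framework (one_grad_step \<alpha>) (avg_obj f) W \<rho> \<eta> X \<Lambda>)) \<and>
         (\<forall>\<Lambda>\<^sub>1. (extra (avg_obj f) W_DS \<alpha> X \<and>
                 one_grad_step \<alpha> (aug_lagrangian (avg_obj f) (lift_mat W) \<rho> \<Lambda>\<^sub>1) (X 0) (X 1)) \<longleftrightarrow>
               (\<exists>\<Lambda>. \<Lambda> 1 = \<Lambda>\<^sub>1 \<and>
                 dec_al_framework (one_grad_step \<alpha>) (avg_obj f) W \<rho> \<eta> X \<Lambda>))"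
proof -
  let ?F = "avg_obj f"
  let ?step1 = "\<lambda>l. one_grad_step \<alpha> (aug_lagrangian ?F (lift_mat W) \<rho> l) (X 0) (X 1)"
  let ?al = "dec_al_framework (one_grad_step \<alpha>) ?F W \<rho> \<rho> X"
  have diff: "?F differentiable (at Y)" for Y
    using assms(1) by (rule differentiable_avg_obj)
  have sym: "transpose W = W"
    using assms(8) by (simp add: mixing_matrix_def)
  have half: "\<alpha> * \<rho> = 1 / 2"
    using assms(9,10) by (auto simp: field_simps)
  note framework_iff = framework_iff_extra_and_first_step[OF diff sym assms(7) half]

  have with_multiplier: "extra ?F W_DS \<alpha> X \<and> ?step1 l \<longleftrightarrow> (\<exists>\<Lambda>. \<Lambda> 1 = l \<and> ?al \<Lambda>)" for l
  proof
    assume *: "extra ?F W_DS \<alpha> X \<and> ?step1 l"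
    \<comment> \<open>The dual update determines the multipliers from \<open>\<Lambda> 1 = l\<close> on; this is its solution.\<close>
    define \<Lambda> where "\<Lambda> k = l + (\<Sum>j\<in>{1..<k}. \<rho> *\<^sub>R (lift_mat W *v X j))" for k
    have "\<Lambda> 1 = l" and "\<And>k. k \<ge> 1 \<Longrightarrow> \<Lambda> (k + 1) = \<Lambda> k + \<rho> *\<^sub>R (lift_mat W *v X k)"
      by (simp_all add: \<Lambda>_def)
    with * framework_iff[of \<Lambda> X] show "\<exists>\<Lambda>. \<Lambda> 1 = l \<and> ?al \<Lambda>" by auto
  next
    assume "\<exists>\<Lambda>. \<Lambda> 1 = l \<and> ?al \<Lambda>"
    then obtain \<Lambda> where \<Lambda>: "\<Lambda> 1 = l" "?al \<Lambda>" by blast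
    then have "\<And>k. k \<ge> 1 \<Longrightarrow> \<Lambda> (k + 1) = \<Lambda> k + \<rho> *\<^sub>R (lift_mat W *v X k)"
      by (simp add: dec_al_framework_def)
    with \<Lambda> framework_iff[of \<Lambda> X] show "extra ?F W_DS \<alpha> X \<and> ?step1 l" by auto
  qed

  \<comment> \<open>The first gradient step, solved for the multiplier.\<close>
  have "?step1 ((1 / \<alpha>) *\<^sub>R (X 0 - X 1) - grad ?F (X 0) - \<rho> *\<^sub>R (lift_mat W *v X 0))"
    using \<open>\<alpha> > 0\<close>
    by (subst one_grad_step_aug_lagrangian_iff[OF diff]) (simp_all add: transpose_lift_mat sym)
  then have "extra ?F W_DS \<alpha> X \<longleftrightarrow> (\<exists>\<Lambda>. ?al \<Lambda>)"
    using with_multiplier by blast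
  then show ?thesis
    unfolding \<open>\<eta> = \<rho>\<close> using with_multiplier by blast
qed

end
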